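(* Consider the single-objective linear program $(T^0)$ in the variables $\epsilon, \lambda_1,\dots,\lambda_k\in\mathbb{R}$ given by $$\begin{aligned} \max\quad & \epsilon\\ \text{subject to}\quad & (\lambda^{T}C)_j = (\lambda^{T}C)_{j+1},\quad \forall j = 1, \dots, n-1,\\ & \lambda_i \geq \epsilon,\quad \forall i = 1, \dots, k,\\ & \epsilon \leq 1. \end{aligned}$$ Then $X_E = X$ if and only if $(T^0)$ has a positive optimal value $\epsilon^{*} > 0$.
   Context: Let $k \ge 2$ and $n \ge 2$ be integers, $c_1,\dots,c_k \in \mathbb{R}^n$, and let $C$ be the $k\times n$ real matrix whose $i$th row is $c_i$, with entries $c_{i,j}$. For $\lambda=(\lambda_1,\dots,\lambda_k)\in\mathbb{R}^k$, $(\lambda^TC)_j=\sum_{i=1}^k\lambda_i c_{i,j}$. Let $X = \{x\in\mathbb{R}^n : \sum_{j=1}^n x_j = 1,\ x_j \ge 0 \text{ for all } j=1,\dots,n\}$. A point $x^{\circ}\in X$ is an efficient solution (of the problem of simultaneously maximizing $c_1^Tx,\dots,c_k^Tx$ over $X$) if there is no $x\in X$ with $c_i^Tx \ge c_i^Tx^{\circ}$ for all $i=1,\dots,k$ and at least one of these inequalities strict. $X_E$ denotes the set of all efficient solutions. *)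

theory Defs
  imports Complex_Main "Jordan_Normal_Form.Matrix"
begin

text \<open>
  Vectors and matrices are those of the Jordan normal form library, so all indices start at 0:
  the objectives \<open>c\<^sub>1, \<dots>, c\<^sub>k\<close> are \<open>row C 0, \<dots>, row C (k - 1)\<close> for a \<open>k \<times> n\<close> matrix \<open>C\<close>.
\<close>

definition std_simplex :: "nat \<Rightarrow> real vec set" where
  "std_simplex n = {x \<in> carrier_vec n. (\<Sum>j<n. x $ j) = 1 \<and> (\<forall>j<n. 0 \<le> x $ j)}"

definition dominates :: "real mat \<Rightarrow> real vec \<Rightarrow> real vec \<Rightarrow> bool" where
  "dominates C x y \<longleftrightarrow>
     (\<forall>i<dim_row C. row C i \<bullet> x \<ge> row C i \<bullet> y) \<and>
     (\<exists>i<dim_row C. row C i \<bullet> x > row C i \<bullet> y)"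

definition efficient_set :: "real mat \<Rightarrow> real vec set \<Rightarrow> real vec set" where
  "efficient_set C X = {x0 \<in> X. \<not> (\<exists>x\<in>X. dominates C x x0)}"

text \<open>The row vector \<open>\<lambda>\<^sup>T C\<close> is represented by the column vector \<open>C\<^sup>T \<lambda>\<close>.\<close>

definition T0_feasible :: "real mat \<Rightarrow> (real \<times> real vec) set" where
  "T0_feasible C = {(\<epsilon>, l). l \<in> carrier_vec (dim_row C) \<and>
     (\<forall>j. j + 1 < dim_col C \<longrightarrow>
        (transpose_mat C *\<^sub>v l) $ j = (transpose_mat C *\<^sub>v l) $ (j + 1)) \<and>
     (\<forall>i<dim_row C. l $ i \<ge> \<epsilon>) \<and>
     \<epsilon> \<le> 1}"

text \<open>An optimal value of a maximization problem is a maximum: it has to be attained.\<close>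

definition is_optimal_value :: "('a \<Rightarrow> real) \<Rightarrow> 'a set \<Rightarrow> real \<Rightarrow> bool" where
  "is_optimal_value f S v \<longleftrightarrow> (\<exists>s\<in>S. f s = v) \<and> (\<forall>s\<in>S. f s \<le> v)"

end

theory Submission
  imports Defs
begin

text \<open>
  Both sides of the equivalence say that some \<open>\<lambda>\<close> with all entries positive makes
  \<open>\<lambda>\<^sup>T C\<close> a constant row. For the linear program this is rescaling: the constraints other than
  \<open>\<epsilon> \<le> 1\<close> are homogeneous, so such a \<open>\<lambda>\<close> can be scaled until its entries are at least 1, and
  then the bound \<open>\<epsilon> = 1\<close> is attained.

  For efficiency, suppose first that such a \<open>\<lambda>\<close> exists. The weighted objective
  \<open>\<Sum>\<^sub>i \<lambda>\<^sub>i c\<^sub>i\<^sup>T x\<close> is constant on the simplex, whereas passing to a dominating point would strictly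
  increase it; hence every point is efficient.

  Conversely, let every point be efficient. If a direction \<open>d\<close> with \<open>\<Sum>\<^sub>j d\<^sub>j = 0\<close> had
  \<open>C d \<ge> 0\<close> and \<open>C d \<noteq> 0\<close>, a short step from the barycentre along \<open>d\<close> would stay in the simplex
  and dominate the barycentre. So the subspace \<open>{C d | \<Sum>\<^sub>j d\<^sub>j = 0}\<close> meets the nonnegative orthant
  only in 0, and Stiemke's lemma (\<open>stiemke_subspace\<close>) yields a positive vector \<open>\<lambda>\<close> orthogonal to
  it. Testing \<open>\<lambda>\<close> against the directions \<open>e\<^sub>j - e\<^sub>j\<^sub>+\<^sub>1\<close> gives the equality constraints.
  Stiemke's lemma in turn is obtained by adding up, over all coordinates, the vectors provided by
  a Farkas alternative for subspaces (\<open>farkas_subspace\<close>), which has a purely algebraic proof by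
  eliminating one coordinate at a time.
\<close>

section \<open>Theorems of the alternative for subspaces\<close>

text \<open>
  The induction removes a coordinate \<open>a\<close>. If the hypothesis survives the removal, \<open>a\<close> gets weight 0.
  Otherwise some \<open>w\<close> in \<open>V\<close> violates it, which forces \<open>w a < 0\<close>. The induction hypothesis applies
  to the subspace where coordinate \<open>a\<close> vanishes, and \<open>V\<close> is this subspace plus the line through
  \<open>w\<close>; the weight of \<open>a\<close> is the unique one that makes the weighted sum of \<open>w\<close> vanish, and it
  is nonnegative because \<open>w\<close> is nonnegative on the remaining coordinates.
\<close>

lemma farkas_subspace:
  fixes V :: "('i \<Rightarrow> real) set"
  assumes "finite I" and "i0 \<notin> I"
    and "\<And>v w t. v \<in> V \<Longrightarrow> w \<in> V \<Longrightarrow> (\<lambda>i. v i + t * w i) \<in> V"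
    and "\<And>v. v \<in> V \<Longrightarrow> (\<And>i. i \<in> I \<Longrightarrow> 0 \<le> v i) \<Longrightarrow> v i0 \<le> 0"
  shows "\<exists>l. (\<forall>i\<in>I. 0 \<le> l i) \<and> (\<forall>v\<in>V. v i0 + (\<Sum>i\<in>I. l i * v i) = 0)"
  using assms
proof (induction I arbitrary: V rule: finite_induct)
  case empty
  have "v i0 = 0" if "v \<in> V" for v
  proof -
    \<comment> \<open>The combination \<open>v - 2 v\<close> is \<open>- v\<close>, so the bound holds for both signs.\<close>
    have "(\<lambda>i. v i + (-2) * v i) \<in> V"
      by (rule empty.prems(2)) (use that in auto)
    then have "v i0 + (-2) * v i0 \<le> 0"
      using empty.prems(3) by fastforce
    moreover have "v i0 \<le> 0"
      using empty.prems(3)[OF that] by simp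
    ultimately show ?thesis by simp
  qed
  then show ?case by simp
next
  case (insert a I)
  have ia: "i0 \<notin> I" "i0 \<noteq> a"
    using insert.prems(1) by auto
  show ?case
  proof (cases "\<forall>v\<in>V. (\<forall>i\<in>I. 0 \<le> v i) \<longrightarrow> v i0 \<le> 0")
    case True
    have "\<exists>l. (\<forall>i\<in>I. 0 \<le> l i) \<and> (\<forall>v\<in>V. v i0 + (\<Sum>i\<in>I. l i * v i) = 0)"
      by (rule insert.IH[OF ia(1) insert.prems(2)]) (use True in auto)
    then obtain l where l: "\<forall>i\<in>I. 0 \<le> l i" "\<forall>v\<in>V. v i0 + (\<Sum>i\<in>I. l i * v i) = 0"
      by blast
    have "(\<Sum>i\<in>I. (l(a := 0)) i * v i) = (\<Sum>i\<in>I. l i * v i)" for v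
      by (rule sum.cong) (use insert.hyps in auto)
    then show ?thesis
      using l insert.hyps by (intro exI[of _ "l(a := 0)"]) simp
  next
    case False
    then obtain w where w: "w \<in> V" "\<forall>i\<in>I. 0 \<le> w i" "w i0 > 0"
      by force
    have wa: "w a < 0"
      using insert.prems(3)[OF w(1)] w(2,3) by force
    define V0 where "V0 = {v \<in> V. v a = 0}"
    have "\<exists>l. (\<forall>i\<in>I. 0 \<le> l i) \<and> (\<forall>v\<in>V0. v i0 + (\<Sum>i\<in>I. l i * v i) = 0)"
    proof (rule insert.IH[OF ia(1)])
      show "(\<lambda>i. u i + t * v i) \<in> V0" if "u \<in> V0" "v \<in> V0" for u v t
        using that insert.prems(2) by (auto simp: V0_def)
      show "v i0 \<le> 0" if "v \<in> V0" "\<And>i. i \<in> I \<Longrightarrow> 0 \<le> v i" for v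
        by (rule insert.prems(3)) (use that in \<open>auto simp: V0_def\<close>)
    qed
    then obtain l where l: "\<forall>i\<in>I. 0 \<le> l i" "\<forall>v\<in>V0. v i0 + (\<Sum>i\<in>I. l i * v i) = 0"
      by blast
    define W where "W = w i0 + (\<Sum>i\<in>I. l i * w i)"
    define la where "la = - W / w a"
    have "W \<ge> 0"
      unfolding W_def using l(1) w(2,3) by (intro add_nonneg_nonneg sum_nonneg) auto
    then have la: "la \<ge> 0"
      unfolding la_def using wa by (intro divide_nonpos_neg) auto
    have "v i0 + (\<Sum>i\<in>I. l i * v i) + la * v a = 0" if "v \<in> V" for v
    proof -
      \<comment> \<open>Subtracting this multiple of \<open>w\<close> makes coordinate \<open>a\<close> vanish.\<close>
      define t where "t = - v a / w a"
      have "(\<lambda>i. v i + t * w i) \<in> V0"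
        unfolding V0_def using insert.prems(2)[OF that w(1), of t] wa by (simp add: t_def)
      then have "(v i0 + t * w i0) + (\<Sum>i\<in>I. l i * (v i + t * w i)) = 0"
        using l(2) by fastforce
      then have "v i0 + (\<Sum>i\<in>I. l i * v i) + t * W = 0"
        by (simp add: W_def algebra_simps sum.distrib sum_distrib_left)
      moreover have "t * W = la * v a"
        by (simp add: t_def la_def)
      ultimately show ?thesis by simp
    qed
    moreover have "(\<Sum>i\<in>I. (l(a := la)) i * v i) = (\<Sum>i\<in>I. l i * v i)" for v
      by (rule sum.cong) (use insert.hyps in auto)
    ultimately show ?thesis
      using l(1) la insert.hyps by (intro exI[of _ "l(a := la)"]) (simp add: algebra_simps)
  qed
qed

text \<open>
  For each coordinate \<open>i\<close> the Farkas alternative gives a nonnegative annihilator of \<open>V\<close> whose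
  entry at \<open>i\<close> is 1. Their sum annihilates \<open>V\<close> and is positive everywhere.
\<close>

lemma stiemke_subspace:
  fixes V :: "('i \<Rightarrow> real) set"
  assumes fin: "finite I"
    and lin: "\<And>v w t. v \<in> V \<Longrightarrow> w \<in> V \<Longrightarrow> (\<lambda>i. v i + t * w i) \<in> V"
    and orthant: "\<And>v i. v \<in> V \<Longrightarrow> (\<And>i. i \<in> I \<Longrightarrow> 0 \<le> v i) \<Longrightarrow> i \<in> I \<Longrightarrow> v i = 0"
  shows "\<exists>l. (\<forall>i\<in>I. 0 < l i) \<and> (\<forall>v\<in>V. (\<Sum>i\<in>I. l i * v i) = 0)"
proof -
  have "\<exists>l. (\<forall>i\<in>I. 0 \<le> l i) \<and> l a = 1 \<and> (\<forall>v\<in>V. (\<Sum>i\<in>I. l i * v i) = 0)"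
    if a: "a \<in> I" for a
  proof -
    have "\<exists>l. (\<forall>i\<in>I - {a}. 0 \<le> l i) \<and> (\<forall>v\<in>V. v a + (\<Sum>i\<in>I - {a}. l i * v i) = 0)"
    proof (rule farkas_subspace)
      show "v a \<le> 0" if v: "v \<in> V" and nonneg: "\<And>i. i \<in> I - {a} \<Longrightarrow> 0 \<le> v i" for v
      proof (rule ccontr)
        assume "\<not> v a \<le> 0"
        moreover from this have "v a = 0"
          using nonneg by (intro orthant[OF v _ a]) force
        ultimately show False by simp
      qed
    qed (use fin lin in auto)
    then obtain l where l: "\<forall>i\<in>I - {a}. 0 \<le> l i"
        "\<forall>v\<in>V. v a + (\<Sum>i\<in>I - {a}. l i * v i) = 0"
      by blast
    have "(\<Sum>i\<in>I. (l(a := 1)) i * v i) = v a + (\<Sum>i\<in>I - {a}. l i * v i)" for v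
      by (simp add: sum.remove[OF fin a])
    then show ?thesis
      using l by (intro exI[of _ "l(a := 1)"]) simp
  qed
  then obtain L where L: "\<And>a i. a \<in> I \<Longrightarrow> i \<in> I \<Longrightarrow> 0 \<le> L a i" "\<And>a. a \<in> I \<Longrightarrow> L a a = 1"
      "\<And>a v. a \<in> I \<Longrightarrow> v \<in> V \<Longrightarrow> (\<Sum>i\<in>I. L a i * v i) = 0"
    by metis
  have "0 < (\<Sum>a\<in>I. L a i)" if "i \<in> I" for i
    by (rule sum_pos2[OF fin that]) (use L that in auto)
  moreover have "(\<Sum>i\<in>I. (\<Sum>a\<in>I. L a i) * v i) = 0" if "v \<in> V" for v
  proof -
    have "(\<Sum>i\<in>I. (\<Sum>a\<in>I. L a i) * v i) = (\<Sum>a\<in>I. \<Sum>i\<in>I. L a i * v i)"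
      unfolding sum_distrib_right by (rule sum.swap)
    also have "\<dots> = 0"
      using L(3) that by simp
    finally show ?thesis .
  qed
  ultimately show ?thesis by (intro exI[of _ "\<lambda>i. \<Sum>a\<in>I. L a i"]) simp
qed

section \<open>Positive weights with a constant weighted objective\<close>

definition equalizing_weights :: "real mat \<Rightarrow> real vec \<Rightarrow> bool" where
  "equalizing_weights C l \<longleftrightarrow> l \<in> carrier_vec (dim_row C) \<and> (\<forall>i<dim_row C. 0 < l $ i) \<and>
     (\<forall>j. j + 1 < dim_col C \<longrightarrow>
        (transpose_mat C *\<^sub>v l) $ j = (transpose_mat C *\<^sub>v l) $ (j + 1))"

lemma transpose_mult_vec_index:
  fixes C :: "'a :: comm_semiring_0 mat"
  assumes "C \<in> carrier_mat k n" "l \<in> carrier_vec k" "j < n"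
  shows "(transpose_mat C *\<^sub>v l) $ j = (\<Sum>i<k. l $ i * C $$ (i, j))"
  using assms by (auto simp: scalar_prod_def mult.commute atLeast0LessThan intro!: sum.cong)

lemma row_scalar_prod_index:
  assumes "C \<in> carrier_mat k n" "x \<in> carrier_vec n" "i < k"
  shows "row C i \<bullet> x = (\<Sum>j<n. C $$ (i, j) * x $ j)"
  using assms by (auto simp: scalar_prod_def atLeast0LessThan intro!: sum.cong)

text \<open>
  The optimal value can only be 1 or nonpositive: positive weights can be scaled up until their
  least entry reaches 1, the upper bound for \<open>\<epsilon>\<close>.
\<close>

lemma positive_optimal_value_iff_equalizing_weights:
  "(\<exists>v. is_optimal_value fst (T0_feasible C) v \<and> v > 0) \<longleftrightarrow> (\<exists>l. equalizing_weights C l)"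
proof
  assume "\<exists>v. is_optimal_value fst (T0_feasible C) v \<and> v > 0"
  then obtain v l where "(v, l) \<in> T0_feasible C" "v > 0"
    by (auto simp: is_optimal_value_def)
  then have "equalizing_weights C l"
    unfolding equalizing_weights_def T0_feasible_def by force
  then show "\<exists>l. equalizing_weights C l" ..
next
  assume "\<exists>l. equalizing_weights C l"
  then obtain l where l: "equalizing_weights C l" ..
  have lc: "l \<in> carrier_vec (dim_row C)"
    and lpos: "\<And>i. i < dim_row C \<Longrightarrow> 0 < l $ i"
    and leq: "\<And>j. j + 1 < dim_col C \<Longrightarrow>
        (transpose_mat C *\<^sub>v l) $ j = (transpose_mat C *\<^sub>v l) $ (j + 1)"
    using l unfolding equalizing_weights_def by blast+
  \<comment> \<open>Inserting 1 keeps the minimum defined when \<open>C\<close> has no rows.\<close>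
  define m where "m = Min (insert 1 ((\<lambda>i. l $ i) ` {..<dim_row C}))"
  have m: "m > 0" "\<And>i. i < dim_row C \<Longrightarrow> m \<le> l $ i"
    using lpos by (auto simp: m_def)
  have scaled: "(transpose_mat C *\<^sub>v ((1 / m) \<cdot>\<^sub>v l)) $ j = (1 / m) * (transpose_mat C *\<^sub>v l) $ j"
    if "j < dim_col C" for j
    using that lc by (simp add: mult_mat_vec[of _ "dim_col C" "dim_row C"])
  have "(transpose_mat C *\<^sub>v ((1 / m) \<cdot>\<^sub>v l)) $ j = (transpose_mat C *\<^sub>v ((1 / m) \<cdot>\<^sub>v l)) $ (j + 1)"
    if "j + 1 < dim_col C" for j
    using scaled[of j] scaled[of "j + 1"] leq[OF that] that by (metis add_lessD1)
  moreover have "1 \<le> ((1 / m) \<cdot>\<^sub>v l) $ i" if "i < dim_row C" for i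
    using that lc m by simp
  ultimately have "(1, (1 / m) \<cdot>\<^sub>v l) \<in> T0_feasible C"
    unfolding T0_feasible_def mem_Collect_eq prod.case
    using smult_carrier_vec lc order_refl by blast
  moreover have "fst s \<le> 1" if "s \<in> T0_feasible C" for s
    using that unfolding T0_feasible_def mem_Collect_eq case_prod_unfold by blast
  ultimately have "is_optimal_value fst (T0_feasible C) 1"
    unfolding is_optimal_value_def by (metis fst_conv)
  then show "\<exists>v. is_optimal_value fst (T0_feasible C) v \<and> v > 0"
    by (intro exI[of _ 1]) simp
qed

text \<open>
  The entries of a point of the simplex sum to 1, so the weighted objective equals the common value
  of the entries of \<open>C\<^sup>T l\<close>.
\<close>

lemma weighted_objective_constant:
  assumes C: "C \<in> carrier_mat k n" and l: "equalizing_weights C l" and x: "x \<in> std_simplex n"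
  shows "(\<Sum>i<k. l $ i * (row C i \<bullet> x)) = (transpose_mat C *\<^sub>v l) $ 0"
proof -
  have lc: "l \<in> carrier_vec k"
    using l unfolding equalizing_weights_def carrier_matD[OF C] by blast
  have const: "(transpose_mat C *\<^sub>v l) $ j = (transpose_mat C *\<^sub>v l) $ 0" if "j < n" for j
    using that
  proof (induction j)
    case (Suc j)
    have "(transpose_mat C *\<^sub>v l) $ j = (transpose_mat C *\<^sub>v l) $ (j + 1)"
      using l C Suc.prems unfolding equalizing_weights_def by (metis Suc_eq_plus1 carrier_matD(2))
    then show ?case
      using Suc.IH Suc.prems unfolding Suc_eq_plus1 by linarith
  qed simp
  have xc: "x \<in> carrier_vec n" and sum1: "(\<Sum>j<n. x $ j) = 1"
    using x by (auto simp: std_simplex_def)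
  have "(\<Sum>i<k. l $ i * (row C i \<bullet> x)) = (\<Sum>i<k. \<Sum>j<n. l $ i * C $$ (i, j) * x $ j)"
    using row_scalar_prod_index[OF C xc] by (simp add: sum_distrib_left mult.assoc)
  also have "\<dots> = (\<Sum>j<n. (\<Sum>i<k. l $ i * C $$ (i, j)) * x $ j)"
    unfolding sum_distrib_right by (rule sum.swap)
  also have "\<dots> = (\<Sum>j<n. (transpose_mat C *\<^sub>v l) $ 0 * x $ j)"
  proof (intro sum.cong refl)
    fix j assume "j \<in> {..<n}"
    then have j: "j < n" by simp
    show "(\<Sum>i<k. l $ i * C $$ (i, j)) * x $ j = (transpose_mat C *\<^sub>v l) $ 0 * x $ j"
      unfolding transpose_mult_vec_index[OF C lc j, symmetric] const[OF j] by (rule refl)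
  qed
  also have "\<dots> = (transpose_mat C *\<^sub>v l) $ 0"
    by (simp add: sum1 flip: sum_distrib_left)
  finally show ?thesis .
qed

lemma equalizing_weights_imp_all_efficient:
  assumes C: "C \<in> carrier_mat k n" and l: "equalizing_weights C l"
  shows "efficient_set C (std_simplex n) = std_simplex n"
proof -
  have lpos: "0 < l $ i" if "i < k" for i
    using l that unfolding equalizing_weights_def carrier_matD[OF C] by blast
  have "\<not> dominates C x y" if "x \<in> std_simplex n" "y \<in> std_simplex n" for x y
  proof
    assume dom: "dominates C x y"
    have "(\<Sum>i<k. l $ i * (row C i \<bullet> y)) < (\<Sum>i<k. l $ i * (row C i \<bullet> x))"
    proof (rule sum_strict_mono_ex1)
      show "\<forall>i\<in>{..<k}. l $ i * (row C i \<bullet> y) \<le> l $ i * (row C i \<bullet> x)"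
        using dom lpos C by (auto simp: dominates_def)
      show "\<exists>i\<in>{..<k}. l $ i * (row C i \<bullet> y) < l $ i * (row C i \<bullet> x)"
        using dom lpos C by (auto simp: dominates_def)
    qed simp
    then show False
      using weighted_objective_constant[OF C l] that by simp
  qed
  then show ?thesis
    by (auto simp: efficient_set_def)
qed

section \<open>Efficiency of the barycentre\<close>

text \<open>
  The barycentre lies in the relative interior of the simplex, so a short enough step in any
  direction \<open>d\<close> of zero sum stays in the simplex. Efficiency of this one point therefore already
  rules out all improving directions.
\<close>

lemma no_improving_direction_at_barycentre:
  fixes d :: "nat \<Rightarrow> real"
  assumes C: "C \<in> carrier_mat k n" and n: "n > 0"
    and eff: "vec n (\<lambda>_. 1 / real n) \<in> efficient_set C (std_simplex n)"
    and d0: "(\<Sum>j<n. d j) = 0"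
    and nonneg: "\<And>i. i < k \<Longrightarrow> 0 \<le> (\<Sum>j<n. C $$ (i, j) * d j)"
    and i: "i < k"
  shows "(\<Sum>j<n. C $$ (i, j) * d j) = 0"
proof (rule ccontr)
  assume "(\<Sum>j<n. C $$ (i, j) * d j) \<noteq> 0"
  then have pos: "0 < (\<Sum>j<n. C $$ (i, j) * d j)"
    using nonneg[OF i] by simp
  define D where "D = 1 + (\<Sum>j<n. \<bar>d j\<bar>)"
  have D: "D > 0"
    unfolding D_def by (intro add_pos_nonneg sum_nonneg) auto
  have dD: "\<bar>d j\<bar> \<le> D" if "j < n" for j
    using member_le_sum[of j "{..<n}" "\<lambda>j. \<bar>d j\<bar>"] that by (simp add: D_def)
  define t where "t = 1 / (real n * D)"
  have t: "t > 0"
    using n D by (simp add: t_def)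
  define b where "b = vec n (\<lambda>_. 1 / real n)"
  define x where "x = vec n (\<lambda>j. 1 / real n + t * d j)"
  have "0 \<le> 1 / real n + t * d j" if "j < n" for j
  proof -
    have "t * (- d j) \<le> t * D"
      using dD[OF that] t by (intro mult_left_mono) auto
    also have "t * D = 1 / real n"
      using D by (simp add: t_def)
    finally show ?thesis by simp
  qed
  then have x: "x \<in> std_simplex n"
    using n d0 by (simp add: std_simplex_def x_def sum.distrib flip: sum_distrib_left)
  have step: "row C r \<bullet> x = row C r \<bullet> b + t * (\<Sum>j<n. C $$ (r, j) * d j)" if "r < k" for r
  proof -
    have "row C r \<bullet> x = (\<Sum>j<n. C $$ (r, j) * (1 / real n) + t * (C $$ (r, j) * d j))"
      by (subst row_scalar_prod_index[OF C _ that]) (auto simp: x_def algebra_simps intro!: sum.cong)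
    also have "\<dots> = row C r \<bullet> b + t * (\<Sum>j<n. C $$ (r, j) * d j)"
      by (subst row_scalar_prod_index[OF C _ that])
         (auto simp: b_def sum.distrib sum_distrib_left)
    finally show ?thesis .
  qed
  have "dominates C x b"
    unfolding dominates_def using C i t pos nonneg step by force
  then show False
    using eff x by (auto simp: efficient_set_def b_def)
qed

lemma all_efficient_imp_equalizing_weights:
  assumes C: "C \<in> carrier_mat k n" and n: "n > 0"
    and eff: "efficient_set C (std_simplex n) = std_simplex n"
  shows "\<exists>l. equalizing_weights C l"
proof -
  have "vec n (\<lambda>_. 1 / real n) \<in> std_simplex n"
    using n by (simp add: std_simplex_def)
  then have bary: "vec n (\<lambda>_. 1 / real n) \<in> efficient_set C (std_simplex n)"
    using eff by simp
  define Cd where "Cd d = (\<lambda>i. \<Sum>j<n. C $$ (i, j) * d j)" for d :: "nat \<Rightarrow> real"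
  define V where "V = Cd ` {d. (\<Sum>j<n. d j) = 0}"
  have "\<exists>l. (\<forall>i\<in>{..<k}. 0 < l i) \<and> (\<forall>v\<in>V. (\<Sum>i<k. l i * v i) = 0)"
  proof (rule stiemke_subspace)
    show "(\<lambda>i. v i + t * w i) \<in> V" if vw: "v \<in> V" "w \<in> V" for v w t
    proof -
      obtain d e where "v = Cd d" "w = Cd e" "(\<Sum>j<n. d j) = 0" "(\<Sum>j<n. e j) = 0"
        using vw unfolding V_def by blast
      moreover from this have "(\<Sum>j<n. d j + t * e j) = 0"
        by (simp add: sum.distrib flip: sum_distrib_left)
      moreover have "(\<lambda>i. Cd d i + t * Cd e i) = Cd (\<lambda>j. d j + t * e j)"
        unfolding Cd_def by (simp add: sum.distrib sum_distrib_left algebra_simps)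
      ultimately show ?thesis
        unfolding V_def by blast
    qed
    show "v i = 0" if "v \<in> V" "\<And>i. i \<in> {..<k} \<Longrightarrow> 0 \<le> v i" "i \<in> {..<k}" for v i
      using that no_improving_direction_at_barycentre[OF C n bary] by (auto simp: V_def Cd_def)
  qed simp
  then obtain l where l: "\<And>i. i < k \<Longrightarrow> 0 < l i" "\<And>v. v \<in> V \<Longrightarrow> (\<Sum>i<k. l i * v i) = 0"
    by auto
  have "(transpose_mat C *\<^sub>v vec k l) $ j = (transpose_mat C *\<^sub>v vec k l) $ (j + 1)"
    if j: "j + 1 < n" for j
  proof -
    define d :: "nat \<Rightarrow> real" where "d p = of_bool (p = j) - of_bool (p = j + 1)" for p
    have pick: "(\<Sum>p<n. f p * d p) = f j - f (j + 1)" for f :: "nat \<Rightarrow> real"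
      using j by (simp add: d_def right_diff_distrib sum_subtractf of_bool_def
          if_distrib[where f = "(*) (f p)" for p] cong: if_cong)
    have "Cd d \<in> V"
      unfolding V_def using pick[of "\<lambda>_. 1"] by simp
    then have "(\<Sum>i<k. l i * (C $$ (i, j) - C $$ (i, j + 1))) = 0"
      using l(2)[of "Cd d"] pick by (simp add: Cd_def)
    then show ?thesis
      using j by (simp add: transpose_mult_vec_index[OF C] right_diff_distrib sum_subtractf)
  qed
  moreover have "vec k l \<in> carrier_vec k" "\<forall>i<k. 0 < vec k l $ i"
    using l(1) by auto
  ultimately have "equalizing_weights C (vec k l)"
    unfolding equalizing_weights_def carrier_matD[OF C] by blast
  then show ?thesis ..
qed

section \<open>The characterization\<close>

theorem proposition1:
  fixes k n :: nat and C :: "real mat"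
  assumes "k \<ge> 2" and "n \<ge> 2" and "C \<in> carrier_mat k n"
  shows "efficient_set C (std_simplex n) = std_simplex n \<longleftrightarrow>
    (\<exists>v. is_optimal_value fst (T0_feasible C) v \<and> v > 0)"
  unfolding positive_optimal_value_iff_equalizing_weights
  using all_efficient_imp_equalizing_weights[OF assms(3)]
    equalizing_weights_imp_all_efficient[OF assms(3)] assms(2)
  by auto

end
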